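(* Let $G$ be a finite group such that $D(G) \leq 2|G|$, where $D(G) = \sum_{N \trianglelefteq G} |N|$. Then any abelian quotient of $G$ is cyclic.
   Context: For a finite group $G$, $D(G) = \sum_{N \trianglelefteq G} |N|$ denotes the sum of the orders of all normal subgroups of $G$ (including the trivial subgroup and $G$ itself). An abelian quotient of $G$ is an abelian group $A$ for which there exists a surjective homomorphism $G \to A$; equivalently, an abelian group isomorphic to $G/K$ for some normal subgroup $K$ of $G$. *)

theory Defs
  imports "HOL-Algebra.Elementary_Groups"
begin

definition normal_order_sum :: "('a, 'c) monoid_scheme \<Rightarrow> nat"
  where "normal_order_sum G = (\<Sum>N | N \<lhd> G. card N)"

(* With A ranging over groups on an arbitrary carrier type, this covers
   in particular the factor groups G Mod K themselves. *)
definition abelian_quotient :: "('a, 'c) monoid_scheme \<Rightarrow> ('b, 'd) monoid_scheme \<Rightarrow> bool"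
  where "abelian_quotient G A \<longleftrightarrow> comm_group A \<and> (\<exists>h. h \<in> epi G A)"

end

theory Submission
  imports Defs
begin

text \<open>If an abelian quotient \<open>A\<close> of \<open>G\<close> is not cyclic, then its nontrivial cyclic subgroups are proper
  and cover \<open>A\<close>, so their preimages are proper normal subgroups of \<open>G\<close> that cover \<open>G\<close> and
  contribute at least \<open>|G|\<close> to \<open>D(G)\<close>. The subgroup \<open>G\<close> itself contributes another \<open>|G|\<close>, and the
  kernel, which is none of these, makes the inequality strict.\<close>

lemma (in group_hom) subgroup_preimage:
  assumes "subgroup K H"
  shows "subgroup {x \<in> carrier G. h x \<in> K} G"
  using assms by (auto intro!: G.subgroupI simp: subgroup_def)

lemma (in group_hom) normal_preimage:
  assumes "K \<lhd> H"
  shows "{x \<in> carrier G. h x \<in> K} \<lhd> G"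
  using assms subgroup_preimage[of K] by (auto simp: G.normal_inv_iff H.normal_inv_iff)

lemma (in comm_group) normal_generate:
  assumes "S \<subseteq> carrier G"
  shows "generate G S \<lhd> G"
  using generate_is_subgroup[OF assms] by (rule subgroup_imp_normal)

lemma (in group) finite_normal_subgroups:
  assumes "finite (carrier G)"
  shows "finite {N. N \<lhd> G}"
proof (rule finite_subset)
  show "{N. N \<lhd> G} \<subseteq> Pow (carrier G)"
    using normal_imp_subgroup subgroup.subset by blast
qed (simp add: assms)

text \<open>The union bound gives at least \<open>order G\<close> from the family alone, overlaps
  only helping. The whole group adds a second \<open>order G\<close>, and \<open>K\<close>, which
  contains the identity, adds at least 1. The side conditions keep these three contributions from
  being counted twice.\<close>

lemma (in group) order_lt_normal_order_sum:
  assumes fin: "finite (carrier G)"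
    and normal: "\<And>N. N \<in> \<N> \<Longrightarrow> N \<lhd> G" and K: "K \<lhd> G" "K \<notin> \<N>" "K \<noteq> carrier G"
    and proper: "carrier G \<notin> \<N>" and cover: "carrier G = \<Union>\<N>"
  shows "2 * order G < normal_order_sum G"
proof -
  have G: "carrier G \<lhd> G"
    by (simp add: normal_inv_iff subgroup_self)
  have finN: "finite \<N>"
    using finite_subset[OF _ finite_normal_subgroups[OF fin], of \<N>] normal by auto
  have finite: "finite N" if "N \<lhd> G" for N
    using finite_subset[OF subgroup.subset[OF normal_imp_subgroup[OF that]] fin] .
  have "order G \<le> (\<Sum>N\<in>\<N>. card N)"
    unfolding order_def cover by (rule card_Union_le_sum_card)
  moreover have "0 < card K"
    using finite[OF K(1)] subgroup.one_closed[OF normal_imp_subgroup[OF K(1)]]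
    by (auto simp: card_gt_0_iff)
  ultimately have "2 * order G < (\<Sum>N\<in>insert (carrier G) (insert K \<N>). card N)"
    using finN K proper by (simp add: order_def)
  also have "\<dots> \<le> normal_order_sum G"
    unfolding normal_order_sum_def
    using finite_normal_subgroups[OF fin] G K normal by (intro sum_mono2) auto
  finally show ?thesis .
qed

lemma (in group) generate_eq_carrier_imp_cyclic:
  assumes "a \<in> carrier G" "generate G {a} = carrier G"
  shows "cyclic_group G"
  unfolding cyclic_group using assms generate_pow[OF assms(1)]
  by (intro bexI[of _ a]) (auto simp: full_SetCompr_eq)

theorem mainTheorem1:
  fixes G :: "('a, 'c) monoid_scheme" and A :: "('b, 'd) monoid_scheme"
  assumes "group G" and "finite (carrier G)"
    and "normal_order_sum G \<le> 2 * order G"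
    and "abelian_quotient G A"
  shows "cyclic_group A"
proof (rule ccontr)
  assume noncyclic: "\<not> cyclic_group A"
  obtain h where "comm_group A" and h: "h \<in> hom G A" and surj: "h ` carrier G = carrier A"
    using assms(4) by (auto simp: abelian_quotient_def epi_def)
  interpret A: comm_group A by fact
  interpret group_hom G A h
    using assms(1) h by (simp add: group_hom_def group_hom_axioms_def A.is_group)
  define P where "P a = {x \<in> carrier G. h x \<in> generate A {a}}" for a
  have normal: "P a \<lhd> G" if "a \<in> carrier A" for a
    unfolding P_def using that by (intro normal_preimage A.normal_generate) simp
  \<comment> \<open>Surjectivity of \<open>h\<close> would turn equality into \<open>a\<close>
    generating \<open>A\<close>. The case where \<open>a\<close> is the identity is included, so the
    kernel is proper as well.\<close>
  have proper: "P a \<noteq> carrier G" if "a \<in> carrier A" for a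
  proof
    assume "P a = carrier G"
    then have "carrier A \<subseteq> generate A {a}"
      by (auto simp: P_def simp flip: surj)
    then show False
      using that noncyclic A.generate_incl[of "{a}"] A.generate_eq_carrier_imp_cyclic by blast
  qed
  \<comment> \<open>The identity of \<open>A\<close> is left out so that its preimage, the kernel of
    \<open>h\<close>, remains available as the extra subgroup \<open>K\<close>.\<close>
  let ?\<N> = "P ` (carrier A - {\<one>\<^bsub>A\<^esub>})"
  have mem: "x \<in> P (h x)" if "x \<in> carrier G" for x
    using that by (simp add: P_def generate.incl)
  have one: "P \<one>\<^bsub>A\<^esub> \<subseteq> P a" for a
    by (auto simp: P_def A.generate_one generate.one)
  have kernel: "P \<one>\<^bsub>A\<^esub> \<notin> ?\<N>"
  proof
    assume "P \<one>\<^bsub>A\<^esub> \<in> ?\<N>"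
    then obtain a where a: "a \<in> carrier A" "a \<noteq> \<one>\<^bsub>A\<^esub>" "P a = P \<one>\<^bsub>A\<^esub>"
      by auto
    \<comment> \<open>A preimage \<open>x\<close> of \<open>a\<close> lies in \<open>P a\<close>,
      hence in the kernel, which forces \<open>a\<close> to be the identity.\<close>
    then obtain x where "x \<in> carrier G" "h x = a"
      by (auto simp flip: surj)
    then show False
      using a mem[of x] by (simp add: P_def A.generate_one)
  qed
  \<comment> \<open>Kernel elements map to the excluded index, so covering them takes some
    nontrivial \<open>b\<close>: the kernel lies inside \<open>P b\<close>.\<close>
  have "\<exists>a\<in>carrier A. a \<noteq> \<one>\<^bsub>A\<^esub>"
    using noncyclic trivial_imp_cyclic_group[of A] A.one_closed
    by (auto simp: trivial_group_def)
  then obtain b where b: "b \<in> carrier A" "b \<noteq> \<one>\<^bsub>A\<^esub>"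
    by blast
  have "x \<in> \<Union>?\<N>" if "x \<in> carrier G" for x
  proof (cases "h x = \<one>\<^bsub>A\<^esub>")
    case True
    then show ?thesis using mem[OF that] one[of b] b by auto
  next
    case False
    then show ?thesis using mem[OF that] that by auto
  qed
  moreover have "\<Union>?\<N> \<subseteq> carrier G"
    by (auto simp: P_def)
  ultimately have cover: "carrier G = \<Union>?\<N>"
    by blast
  have "2 * order G < normal_order_sum G"
  proof (rule order_lt_normal_order_sum[OF assms(2) _ _ kernel _ _ cover])
    show "carrier G \<notin> ?\<N>"
      using proper by (metis DiffD1 imageE)
  qed (use normal proper in auto)
  then show False
    using assms(3) by simp
qed

end
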